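(* Let $\mathfrak K=(K,R,{}^*,\{0\})$ be a frame (so $0\in K$). (1) $\mathfrak K$ is a $\mathsf{CR}^*$-frame satisfying left reflection ($Rxyz\Rightarrow Rx^*zy$ for all $x,y,z\in K$) if and only if $\mathfrak{Cm}(\mathfrak K)$ is a dense commutative relation algebra. (2) $\mathfrak K$ is a $\mathsf{KR}$-frame if and only if $\mathfrak{Cm}(\mathfrak K)$ is a dense symmetric relation algebra.
   Context: A frame is $\mathfrak K=(K,R,{}^*,\mathcal I)$ with $K$ a set, $R\subseteq K^3$, ${}^*\colon K\to K$, $\mathcal I\subseteq K$. Its complex algebra $\mathfrak{Cm}(\mathfrak K)$ is $(\wp(K),\cup,\overline{\phantom a},;,{}^\smile,\mathcal I)$ with $\overline X=K\setminus X$, $X;Y=\{z:Rxyz\text{ for some }x\in X,y\in Y\}$, $X^\smile=\{z^*:z\in X\}$. A $\mathsf{CR}^*$-frame is a frame with $\mathcal I=\{0\}$ such that for all $a,b,c,d\in K$: (p1) $R0ab\Leftrightarrow a=b$; (p2) $\exists x(Rabx\land Rxcd)\Leftrightarrow\exists y(Racy\land Rybd)$; (p3) $Raaa$; (p4) $a^{**}=a$; (p5) $Rabc\Leftrightarrow Rac^*b^*$. A $\mathsf{KR}$-frame is a $\mathsf{CR}^*$-frame with $x^*=x$ for all $x\in K$. A relation algebra is an algebra $(U,+,\overline{\phantom a},;,{}^\smile,1')$ satisfying, for all $a,b,c\in U$: $a+b=b+a$; $a+(b+c)=(a+b)+c$; $\overline{\overline a+\overline b}+\overline{\overline a+b}=a$;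 $a;(b;c)=(a;b);c$; $(a+b);c=a;c+b;c$; $a;1'=a$; $a^{\smile\smile}=a$; $(a+b)^\smile=a^\smile+b^\smile$; $(a;b)^\smile=b^\smile;a^\smile$; $a^\smile;\overline{a;b}+\overline b=\overline b$. Write $x\le y$ for $x+y=y$. The algebra is dense if $x\le x;x$ for all $x$, commutative if $x;y=y;x$ for all $x,y$, symmetric if $x^\smile=x$ for all $x$. *)

theory Defs
  imports Main "HOL-Library.FuncSet"
begin

record 'a frame_sig =
  points :: "'a set"
  trel :: "('a \<times> 'a \<times> 'a) set"
  star :: "'a \<Rightarrow> 'a"
  idents :: "'a set"

locale frame =
  fixes K :: "('a, 'b) frame_sig_scheme"  (structure)
  assumes trel_subset: "trel K \<subseteq> points K \<times> points K \<times> points K"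
    and star_closed: "star K \<in> points K \<rightarrow> points K"
    and idents_subset: "idents K \<subseteq> points K"

text \<open>
  The point \<open>z\<close> plays the role of \<open>0\<close>. The values of \<open>star K\<close> outside
  \<open>points K\<close> are irrelevant, so all laws are relativised to \<open>points K\<close>.
\<close>

locale CR_star_frame = frame K for K :: "('a, 'b) frame_sig_scheme" (structure) +
  fixes z :: 'a
  assumes idents_eq: "idents K = {z}"
    and p1: "\<lbrakk>a \<in> points K; b \<in> points K\<rbrakk> \<Longrightarrow> (z, a, b) \<in> trel K \<longleftrightarrow> a = b"
    and p2: "\<lbrakk>a \<in> points K; b \<in> points K; c \<in> points K; d \<in> points K\<rbrakk> \<Longrightarrow>
      (\<exists>x\<in>points K. (a, b, x) \<in> trel K \<and> (x, c, d) \<in> trel K) \<longleftrightarrow>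
      (\<exists>y\<in>points K. (a, c, y) \<in> trel K \<and> (y, b, d) \<in> trel K)"
    and p3: "a \<in> points K \<Longrightarrow> (a, a, a) \<in> trel K"
    and p4: "a \<in> points K \<Longrightarrow> star K (star K a) = a"
    and p5: "\<lbrakk>a \<in> points K; b \<in> points K; c \<in> points K\<rbrakk> \<Longrightarrow>
      (a, b, c) \<in> trel K \<longleftrightarrow> (a, star K c, star K b) \<in> trel K"

locale KR_frame = CR_star_frame +
  assumes star_id: "x \<in> points K \<Longrightarrow> star K x = x"

definition left_reflection :: "('a, 'b) frame_sig_scheme \<Rightarrow> bool" where
  "left_reflection K \<longleftrightarrow>
    (\<forall>x\<in>points K. \<forall>y\<in>points K. \<forall>w\<in>points K.
      (x, y, w) \<in> trel K \<longrightarrow> (star K x, w, y) \<in> trel K)"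

record 'u alg_sig =
  univ :: "'u set"
  join :: "'u \<Rightarrow> 'u \<Rightarrow> 'u"  (infixl \<open>\<oplus>\<index>\<close> 65)
  cmpl :: "'u \<Rightarrow> 'u"  (\<open>\<sim>\<index> _\<close> [81] 80)
  rcomp :: "'u \<Rightarrow> 'u \<Rightarrow> 'u"  (infixl \<open>\<Zsemi>\<index>\<close> 70)
  rconv :: "'u \<Rightarrow> 'u"  (\<open>_\<^sup>\<smile>\<index>\<close> [1000] 999)
  rident :: "'u"  (\<open>\<one>''\<index>\<close>)

locale relation_algebra =
  fixes A :: "('u, 'b) alg_sig_scheme"  (structure)
  assumes join_closed: "\<lbrakk>a \<in> univ A; b \<in> univ A\<rbrakk> \<Longrightarrow> a \<oplus> b \<in> univ A"
    and cmpl_closed: "a \<in> univ A \<Longrightarrow> \<sim> a \<in> univ A"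
    and rcomp_closed: "\<lbrakk>a \<in> univ A; b \<in> univ A\<rbrakk> \<Longrightarrow> a \<Zsemi> b \<in> univ A"
    and rconv_closed: "a \<in> univ A \<Longrightarrow> a\<^sup>\<smile> \<in> univ A"
    and rident_closed: "\<one>' \<in> univ A"
    and join_commute: "\<lbrakk>a \<in> univ A; b \<in> univ A\<rbrakk> \<Longrightarrow> a \<oplus> b = b \<oplus> a"
    and join_assoc: "\<lbrakk>a \<in> univ A; b \<in> univ A; c \<in> univ A\<rbrakk> \<Longrightarrow> a \<oplus> (b \<oplus> c) = (a \<oplus> b) \<oplus> c"
    and huntington: "\<lbrakk>a \<in> univ A; b \<in> univ A\<rbrakk> \<Longrightarrow> \<sim> (\<sim> a \<oplus> \<sim> b) \<oplus> \<sim> (\<sim> a \<oplus> b) = a"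
    and rcomp_assoc: "\<lbrakk>a \<in> univ A; b \<in> univ A; c \<in> univ A\<rbrakk> \<Longrightarrow> a \<Zsemi> (b \<Zsemi> c) = (a \<Zsemi> b) \<Zsemi> c"
    and rcomp_distrib: "\<lbrakk>a \<in> univ A; b \<in> univ A; c \<in> univ A\<rbrakk> \<Longrightarrow> (a \<oplus> b) \<Zsemi> c = (a \<Zsemi> c) \<oplus> (b \<Zsemi> c)"
    and rcomp_ident: "a \<in> univ A \<Longrightarrow> a \<Zsemi> \<one>' = a"
    and rconv_invol: "a \<in> univ A \<Longrightarrow> (a\<^sup>\<smile>)\<^sup>\<smile> = a"
    and rconv_join: "\<lbrakk>a \<in> univ A; b \<in> univ A\<rbrakk> \<Longrightarrow> (a \<oplus> b)\<^sup>\<smile> = a\<^sup>\<smile> \<oplus> b\<^sup>\<smile>"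
    and rconv_rcomp: "\<lbrakk>a \<in> univ A; b \<in> univ A\<rbrakk> \<Longrightarrow> (a \<Zsemi> b)\<^sup>\<smile> = b\<^sup>\<smile> \<Zsemi> a\<^sup>\<smile>"
    and tarski: "\<lbrakk>a \<in> univ A; b \<in> univ A\<rbrakk> \<Longrightarrow> (a\<^sup>\<smile> \<Zsemi> \<sim> (a \<Zsemi> b)) \<oplus> \<sim> b = \<sim> b"

definition alg_le :: "('u, 'b) alg_sig_scheme \<Rightarrow> 'u \<Rightarrow> 'u \<Rightarrow> bool" where
  "alg_le A x y \<longleftrightarrow> x \<oplus>\<^bsub>A\<^esub> y = y"

definition alg_dense :: "('u, 'b) alg_sig_scheme \<Rightarrow> bool" where
  "alg_dense A \<longleftrightarrow> (\<forall>x\<in>univ A. alg_le A x (x \<Zsemi>\<^bsub>A\<^esub> x))"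

definition alg_commutative :: "('u, 'b) alg_sig_scheme \<Rightarrow> bool" where
  "alg_commutative A \<longleftrightarrow> (\<forall>x\<in>univ A. \<forall>y\<in>univ A. x \<Zsemi>\<^bsub>A\<^esub> y = y \<Zsemi>\<^bsub>A\<^esub> x)"

definition alg_symmetric :: "('u, 'b) alg_sig_scheme \<Rightarrow> bool" where
  "alg_symmetric A \<longleftrightarrow> (\<forall>x\<in>univ A. x\<^sup>\<smile>\<^bsub>A\<^esub> = x)"

definition complex_algebra :: "('a, 'b) frame_sig_scheme \<Rightarrow> 'a set alg_sig" where
  "complex_algebra K =
    \<lparr>univ = Pow (points K),
     join = (\<union>),
     cmpl = (\<lambda>X. points K - X),
     rcomp = (\<lambda>X Y. {w \<in> points K. \<exists>x\<in>X. \<exists>y\<in>Y. (x, y, w) \<in> trel K}),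
     rconv = (\<lambda>X. star K ` X),
     rident = idents K\<rparr>"

end

theory Submission
  imports Defs
begin

text \<open>
  Evaluated at singletons, the identities of the complex algebra are conditions on \<open>trel K\<close>.
  Commutativity of the relation is not among the frame laws; it is \<open>p2\<close> with \<open>a = z\<close>, and it
  turns \<open>p2\<close> into associativity. Left reflection is the relational form of Tarski's law, and
  together with \<open>p5\<close> it says that \<open>star K\<close> preserves \<open>trel K\<close>, which is distributivity of
  converse over composition. For KR-frames, \<open>p5\<close> itself is left reflection, and symmetry of the
  algebra implies commutativity because \<open>x ; y = (x ; y)\<^sup>\<smile> = y\<^sup>\<smile> ; x\<^sup>\<smile> = y ; x\<close>.
\<close>

context frame
begin

lemma star_in [simp]: "x \<in> points K \<Longrightarrow> star K x \<in> points K"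
  using star_closed by auto

lemma complex_algebra_simps:
  "univ (complex_algebra K) = Pow (points K)"
  "join (complex_algebra K) X Y = X \<union> Y"
  "cmpl (complex_algebra K) X = points K - X"
  "rcomp (complex_algebra K) X Y = {w \<in> points K. \<exists>x\<in>X. \<exists>y\<in>Y. (x, y, w) \<in> trel K}"
  "rconv (complex_algebra K) X = star K ` X"
  "rident (complex_algebra K) = idents K"
  by (simp_all add: complex_algebra_def)

end

section \<open>Algebraic laws of the complex algebra of a CR*-frame\<close>

context CR_star_frame
begin

lemma z_in [simp]: "z \<in> points K"
  using idents_eq idents_subset by auto

lemma trel_commute:
  assumes "a \<in> points K" "b \<in> points K" "c \<in> points K"
  shows "(a, b, c) \<in> trel K \<longleftrightarrow> (b, a, c) \<in> trel K"
  \<comment> \<open>With \<open>z\<close> as first argument of \<open>p2\<close>, \<open>p1\<close>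
    forces the two intermediate points to be \<open>a\<close> and \<open>b\<close>.\<close>
  using p2[OF z_in assms] p1 assms by blast

lemma trel_ident_right:
  assumes "a \<in> points K" "b \<in> points K"
  shows "(a, z, b) \<in> trel K \<longleftrightarrow> a = b"
  using assms p1 trel_commute z_in by blast

text \<open>\<open>p2\<close> exchanges the second and third factors of a product bracketed to the
  left. Commuting \<open>a\<close> and \<open>b\<close> beforehand, and \<open>a\<close> with the
  intermediate point afterwards, turns this exchange into a change of brackets.\<close>

lemma trel_assoc:
  assumes "a \<in> points K" "b \<in> points K" "c \<in> points K" "d \<in> points K"
  shows "(\<exists>y\<in>points K. (b, c, y) \<in> trel K \<and> (a, y, d) \<in> trel K) \<longleftrightarrow>
    (\<exists>x\<in>points K. (a, b, x) \<in> trel K \<and> (x, c, d) \<in> trel K)"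
proof -
  have "(\<exists>x\<in>points K. (a, b, x) \<in> trel K \<and> (x, c, d) \<in> trel K) \<longleftrightarrow>
      (\<exists>x\<in>points K. (b, a, x) \<in> trel K \<and> (x, c, d) \<in> trel K)"
    using trel_commute assms by blast
  also have "\<dots> \<longleftrightarrow> (\<exists>y\<in>points K. (b, c, y) \<in> trel K \<and> (y, a, d) \<in> trel K)"
    using p2 assms by blast
  also have "\<dots> \<longleftrightarrow> (\<exists>y\<in>points K. (b, c, y) \<in> trel K \<and> (a, y, d) \<in> trel K)"
    using trel_commute assms by blast
  finally show ?thesis by simp
qed

text \<open>Left reflection takes \<open>(a, b, c)\<close> to \<open>(star K a, c, b)\<close>, and
  \<open>p5\<close> takes that to the starred triple. The other direction is the same argument for
  the starred points, by \<open>p4\<close>.\<close>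

lemma trel_star:
  assumes "left_reflection K" "a \<in> points K" "b \<in> points K" "c \<in> points K"
  shows "(star K a, star K b, star K c) \<in> trel K \<longleftrightarrow> (a, b, c) \<in> trel K"
proof -
  have "(star K a, star K b, star K c) \<in> trel K"
    if "(a, b, c) \<in> trel K" "a \<in> points K" "b \<in> points K" "c \<in> points K" for a b c
    using that assms(1) p5[of "star K a" c b] by (simp add: left_reflection_def)
  from this[of a b c] this[of "star K a" "star K b" "star K c"] show ?thesis
    using assms p4 by auto
qed

lemma relation_algebra_complex_algebra:
  assumes "left_reflection K"
  shows "relation_algebra (complex_algebra K)"
proof (unfold_locales, unfold complex_algebra_simps)
  fix A B C
  assume ABC: "A \<in> Pow (points K)" "B \<in> Pow (points K)" "C \<in> Pow (points K)"
  let ?comp = "\<lambda>X Y. {w \<in> points K. \<exists>x\<in>X. \<exists>y\<in>Y. (x, y, w) \<in> trel K}"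
  show "?comp A (?comp B C) = ?comp (?comp A B) C"
  proof -
    have "(\<exists>a\<in>A. \<exists>y\<in>?comp B C. (a, y, d) \<in> trel K) \<longleftrightarrow>
        (\<exists>x\<in>?comp A B. \<exists>c\<in>C. (x, c, d) \<in> trel K)" if d: "d \<in> points K" for d
    proof -
      have "(\<exists>a\<in>A. \<exists>y\<in>?comp B C. (a, y, d) \<in> trel K) \<longleftrightarrow>
          (\<exists>a\<in>A. \<exists>b\<in>B. \<exists>c\<in>C. \<exists>y\<in>points K. (b, c, y) \<in> trel K \<and> (a, y, d) \<in> trel K)"
        by blast
      also have "\<dots> \<longleftrightarrow>
          (\<exists>a\<in>A. \<exists>b\<in>B. \<exists>c\<in>C. \<exists>x\<in>points K. (a, b, x) \<in> trel K \<and> (x, c, d) \<in> trel K)"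
        using ABC d by (intro bex_cong refl trel_assoc) auto
      also have "\<dots> \<longleftrightarrow> (\<exists>x\<in>?comp A B. \<exists>c\<in>C. (x, c, d) \<in> trel K)"
        by blast
      finally show ?thesis .
    qed
    then show ?thesis by blast
  qed
next
  fix A assume "A \<in> Pow (points K)"
  then show "{w \<in> points K. \<exists>x\<in>A. \<exists>y\<in>idents K. (x, y, w) \<in> trel K} = A"
    using trel_ident_right by (auto simp: idents_eq)
next
  fix A assume "A \<in> Pow (points K)"
  then show "star K ` star K ` A = A"
    using p4 by (force simp: image_image)
next
  fix A B assume AB: "A \<in> Pow (points K)" "B \<in> Pow (points K)"
  show "star K ` {w \<in> points K. \<exists>x\<in>A. \<exists>y\<in>B. (x, y, w) \<in> trel K} =
      {w \<in> points K. \<exists>x\<in>star K ` B. \<exists>y\<in>star K ` A. (x, y, w) \<in> trel K}" (is "?L = ?R")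
  proof -
    \<comment> \<open>By \<open>p4\<close> every point is a star, so both inclusions can be tested
      at points \<open>star K w\<close>. There \<open>trel_star\<close> removes the stars and
      commutativity restores the order of the factors.\<close>
    have conv: "star K w \<in> ?R \<longleftrightarrow> (\<exists>x\<in>A. \<exists>y\<in>B. (x, y, w) \<in> trel K)"
      if w: "w \<in> points K" for w
    proof -
      have "(star K y, star K x, star K w) \<in> trel K \<longleftrightarrow> (x, y, w) \<in> trel K"
        if "x \<in> A" "y \<in> B" for x y
        using that AB w trel_star[OF assms, of y x w] trel_commute[of x y w] by blast
      then show ?thesis using w by auto
    qed
    show ?thesis
    proof
      show "?L \<subseteq> ?R" using conv by blast
      show "?R \<subseteq> ?L"
      proof
        fix v assume v: "v \<in> ?R"
        then have "v = star K (star K v)" "star K v \<in> points K" using p4 by auto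
        then show "v \<in> ?L" using v conv[of "star K v"] by auto
      qed
    qed
  qed
next
  fix A B assume AB: "A \<in> Pow (points K)" "B \<in> Pow (points K)"
  \<comment> \<open>This is left reflection at \<open>star K x\<close>. If \<open>w\<close> lies
    outside \<open>A ; B\<close> and \<open>x\<close> is in \<open>A\<close>, it keeps
    \<open>y\<close> out of \<open>B\<close>, which is Tarski's law.\<close>
  have "(x, y, w) \<in> trel K"
    if "x \<in> points K" "y \<in> points K" "w \<in> points K" "(star K x, w, y) \<in> trel K" for x y w
    using that assms star_in p4 unfolding left_reflection_def by metis
  then show "{w \<in> points K. \<exists>x\<in>star K ` A. \<exists>y\<in>points K -
        {w \<in> points K. \<exists>x\<in>A. \<exists>y\<in>B. (x, y, w) \<in> trel K}. (x, y, w) \<in> trel K}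
      \<union> (points K - B) = points K - B"
    using AB by blast
\<comment> \<open>What remains is closure, the Boolean laws, and distribution of composition and
  converse over unions.\<close>
qed (use idents_subset in auto)

lemma alg_dense_complex_algebra: "alg_dense (complex_algebra K)"
  unfolding alg_dense_def alg_le_def complex_algebra_simps using p3 by blast

lemma alg_commutative_complex_algebra: "alg_commutative (complex_algebra K)"
  unfolding alg_commutative_def complex_algebra_simps using trel_commute by blast

end

lemma (in KR_frame) left_reflection: "left_reflection K"
  using p5 star_id by (simp add: left_reflection_def)

lemma (in KR_frame) alg_symmetric_complex_algebra: "alg_symmetric (complex_algebra K)"
  unfolding alg_symmetric_def complex_algebra_simps using star_id by force

lemma (in relation_algebra) alg_symmetric_imp_commutative:
  assumes "alg_symmetric A"
  shows "alg_commutative A"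
  using assms rconv_rcomp rcomp_closed unfolding alg_symmetric_def alg_commutative_def by metis

section \<open>Frame conditions recovered from the complex algebra\<close>

context frame
begin

text \<open>Recovers \<open>trel K\<close> from the algebra, so that an identity taken at singletons
  becomes a condition on triples of points.\<close>

lemma rcomp_singletons:
  "rcomp (complex_algebra K) {a} {b} = {w. (a, b, w) \<in> trel K}"
  using trel_subset by (auto simp: complex_algebra_simps)

lemma CR_star_frame_if_complex_algebra:
  assumes idents: "idents K = {z}"
    and RA: "relation_algebra (complex_algebra K)"
    and dense: "alg_dense (complex_algebra K)"
    and comm: "alg_commutative (complex_algebra K)"
  shows "CR_star_frame K z" and "left_reflection K"
proof -
  interpret RA: relation_algebra "complex_algebra K" by (rule RA)
  have z: "z \<in> points K" using idents idents_subset by auto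
  have univ: "{a} \<in> univ (complex_algebra K)" if "a \<in> points K" for a
    using that by (simp add: complex_algebra_simps)
  have commute: "(a, b, c) \<in> trel K \<longleftrightarrow> (b, a, c) \<in> trel K"
    if "a \<in> points K" "b \<in> points K" for a b c
  proof -
    have "rcomp (complex_algebra K) {a} {b} = rcomp (complex_algebra K) {b} {a}"
      using comm that univ unfolding alg_commutative_def by blast
    then show ?thesis unfolding rcomp_singletons by blast
  qed
  have ident: "(z, a, b) \<in> trel K \<longleftrightarrow> a = b" if "a \<in> points K" for a b
  proof -
    have "{w. (a, z, w) \<in> trel K} = {a}"
      using RA.rcomp_ident[OF univ[OF that]]
      by (simp add: rcomp_singletons complex_algebra_simps(6) idents)
    \<comment> \<open>The algebra has \<open>z\<close> as a right identity; \<open>p1\<close> is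
      about the left, hence the use of \<open>commute\<close>.\<close>
    from eqset_imp_iff[OF this, of b] show ?thesis using commute[OF z that, of b] by auto
  qed
  have assoc: "(\<exists>y\<in>points K. (b, c, y) \<in> trel K \<and> (a, y, d) \<in> trel K) \<longleftrightarrow>
      (\<exists>x\<in>points K. (a, b, x) \<in> trel K \<and> (x, c, d) \<in> trel K)"
    if "a \<in> points K" "b \<in> points K" "c \<in> points K" "d \<in> points K" for a b c d
  proof -
    have "d \<in> rcomp (complex_algebra K) {a} (rcomp (complex_algebra K) {b} {c}) \<longleftrightarrow>
        d \<in> rcomp (complex_algebra K) (rcomp (complex_algebra K) {a} {b}) {c}"
      using RA.rcomp_assoc that univ by simp
    then show ?thesis using that by (auto simp: complex_algebra_simps)
  qed
  have invol: "star K (star K a) = a" if "a \<in> points K" for a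
    using RA.rconv_invol[OF univ[OF that]] by (simp add: complex_algebra_simps)
  have conv: "(star K b, star K a, star K c) \<in> trel K" if "(a, b, c) \<in> trel K" for a b c
  proof -
    have "a \<in> points K" "b \<in> points K" using that trel_subset by auto
    then have "star K ` {w. (a, b, w) \<in> trel K} = {w. (star K b, star K a, w) \<in> trel K}"
      using RA.rconv_rcomp[OF univ univ, of a b]
      by (simp add: rcomp_singletons complex_algebra_simps(5))
    then show ?thesis using that by blast
  qed
  \<comment> \<open>Tarski's law for \<open>{star K x}\<close> and \<open>{w}\<close>: were the
    conclusion false, \<open>y\<close> would lie in the complement of their product. As
    \<open>{x}\<close> is the converse of \<open>{star K x}\<close>, \<open>R\<close> would then put
    \<open>w\<close> in the complement of \<open>{w}\<close>.\<close>
  have reflect: "(star K x, w, y) \<in> trel K" if R: "(x, y, w) \<in> trel K" for x y w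
  proof (rule ccontr)
    assume "(star K x, w, y) \<notin> trel K"
    moreover have in_K: "x \<in> points K" "y \<in> points K" "w \<in> points K"
      using R trel_subset by auto
    ultimately show False
      using RA.tarski[OF univ univ, of "star K x" w] R
      by (auto simp: complex_algebra_simps invol)
  qed
  then show "left_reflection K" by (simp add: left_reflection_def)
  \<comment> \<open>One half of \<open>p5\<close>: star the whole triple, then reflect, where the
    double star on \<open>a\<close> cancels. The other half is this one applied to the starred
    triple.\<close>
  have star_swap: "(a, star K c, star K b) \<in> trel K" if R: "(a, b, c) \<in> trel K" for a b c
  proof -
    have in_K: "a \<in> points K" "b \<in> points K" using R trel_subset by auto
    then have "(star K a, star K b, star K c) \<in> trel K"
      using conv[OF R] commute by auto
    from reflect[OF this] show ?thesis using in_K invol by simp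
  qed
  show "CR_star_frame K z"
  proof
    fix a b c d
    assume abcd: "a \<in> points K" "b \<in> points K" "c \<in> points K" "d \<in> points K"
    \<comment> \<open>The exchange law \<open>p2\<close> is associativity for \<open>b\<close>,
      \<open>a\<close>, \<open>c\<close> between two uses of commutativity.\<close>
    have "(\<exists>x\<in>points K. (a, b, x) \<in> trel K \<and> (x, c, d) \<in> trel K) \<longleftrightarrow>
        (\<exists>x\<in>points K. (b, a, x) \<in> trel K \<and> (x, c, d) \<in> trel K)"
      using commute abcd by blast
    also have "\<dots> \<longleftrightarrow> (\<exists>y\<in>points K. (a, c, y) \<in> trel K \<and> (b, y, d) \<in> trel K)"
      using assoc abcd by blast
    also have "\<dots> \<longleftrightarrow> (\<exists>y\<in>points K. (a, c, y) \<in> trel K \<and> (y, b, d) \<in> trel K)"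
      using commute abcd by blast
    finally show "(\<exists>x\<in>points K. (a, b, x) \<in> trel K \<and> (x, c, d) \<in> trel K) \<longleftrightarrow>
        (\<exists>y\<in>points K. (a, c, y) \<in> trel K \<and> (y, b, d) \<in> trel K)" .
  next
    fix a assume a: "a \<in> points K"
    then have "{a} \<subseteq> rcomp (complex_algebra K) {a} {a}"
      using dense univ unfolding alg_dense_def alg_le_def complex_algebra_simps(2) by blast
    then show "(a, a, a) \<in> trel K" by (simp add: rcomp_singletons)
  next
    fix a b c assume "a \<in> points K" "b \<in> points K" "c \<in> points K"
    then show "(a, b, c) \<in> trel K \<longleftrightarrow> (a, star K c, star K b) \<in> trel K"
      using star_swap[of a b c] star_swap[of a "star K c" "star K b"] invol by auto
  qed (use idents ident invol in auto)
qed

lemma star_id_if_alg_symmetric: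
  assumes "alg_symmetric (complex_algebra K)" "x \<in> points K"
  shows "star K x = x"
proof -
  have "star K ` {x} = {x}"
    using assms unfolding alg_symmetric_def complex_algebra_simps by blast
  then show ?thesis by simp
qed

end

theorem theorem14:
  fixes K :: "'a frame_sig" and z :: 'a
  assumes "frame K" and "idents K = {z}"
  shows "(CR_star_frame K z \<and> left_reflection K \<longleftrightarrow>
           relation_algebra (complex_algebra K) \<and> alg_dense (complex_algebra K)
             \<and> alg_commutative (complex_algebra K))
       \<and> (KR_frame K z \<longleftrightarrow>
           relation_algebra (complex_algebra K) \<and> alg_dense (complex_algebra K)
             \<and> alg_symmetric (complex_algebra K))"
proof (intro conjI iffI; (elim conjE)?)
  assume "CR_star_frame K z" "left_reflection K"
  then show "relation_algebra (complex_algebra K)" "alg_dense (complex_algebra K)"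
    "alg_commutative (complex_algebra K)"
    by (simp_all add: CR_star_frame.relation_algebra_complex_algebra
        CR_star_frame.alg_dense_complex_algebra CR_star_frame.alg_commutative_complex_algebra)
next
  assume "relation_algebra (complex_algebra K)" "alg_dense (complex_algebra K)"
    "alg_commutative (complex_algebra K)"
  then show "CR_star_frame K z" "left_reflection K"
    using frame.CR_star_frame_if_complex_algebra[OF assms] by auto
next
  assume "KR_frame K z"
  then interpret KR_frame K z .
  show "relation_algebra (complex_algebra K)" "alg_dense (complex_algebra K)"
    "alg_symmetric (complex_algebra K)"
    by (rule relation_algebra_complex_algebra[OF left_reflection] alg_dense_complex_algebra
        alg_symmetric_complex_algebra)+
next
  assume RA: "relation_algebra (complex_algebra K)" and dense: "alg_dense (complex_algebra K)"
    and symm: "alg_symmetric (complex_algebra K)"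
  \<comment> \<open>Symmetry supplies the commutativity that the first equivalence asks for; at
    singletons it also makes \<open>star K\<close> the identity on points.\<close>
  have "CR_star_frame K z"
    using frame.CR_star_frame_if_complex_algebra[OF assms RA dense]
      relation_algebra.alg_symmetric_imp_commutative[OF RA symm] by blast
  then show "KR_frame K z"
    by (intro KR_frame.intro KR_frame_axioms.intro frame.star_id_if_alg_symmetric[OF assms(1) symm])
qed

end
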